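(* Let $G$ be a finite undirected multigraph without loops on $n$ vertices. Let $\Delta$ be its maximal edge multiplicity, and assume $\Delta \geqslant 1$. Let $d_1 \leqslant \dots \leqslant d_n$ be its degree sequence, and let $\tau(G)$ be the number of spanning trees of $G$. Then the inequality $$\tau(G) \leqslant \frac{(\Delta+d_1)(\Delta+d_2)\cdots(\Delta+d_n)}{\Delta\, n^2}$$ turns into an equality if and only if $G$ is a complete multigraph with all edge multiplicities equal to $\Delta$, i.e. every two distinct vertices of $G$ are joined by exactly $\Delta$ edges.
   Context: In a multigraph, two distinct vertices may be joined by several (parallel, distinguishable) edges; the multiplicity of a pair of distinct vertices is the number of edges joining them. The maximal edge multiplicity $\Delta$ is the maximum of these multiplicities over all pairs of distinct vertices. The degree of a vertex is the number of edges incident to it, counted with multiplicity. $\tau(G)$ counts spanning trees with parallel edges regarded as distinct, i.e. it is the number of sets of edges of $G$ that form a tree on all vertices of $G$. The displayed inequality holds for every such $G$. *)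

theory Defs
  imports Complex_Main "HOL-Library.Multiset"
begin

(* Parallel edges are distinct elements of edge_set with the same set of ends. *)
record ('a, 'b) multigraph =
  vertices :: "'a set"
  edge_set :: "'b set"
  ends :: "'b \<Rightarrow> 'a set"

definition finite_loopless_multigraph :: "('a, 'b) multigraph \<Rightarrow> bool" where
  "finite_loopless_multigraph G \<longleftrightarrow>
     finite (vertices G) \<and> finite (edge_set G) \<and>
     (\<forall>e \<in> edge_set G. ends G e \<subseteq> vertices G \<and> card (ends G e) = 2)"

definition edge_multiplicity :: "('a, 'b) multigraph \<Rightarrow> 'a \<Rightarrow> 'a \<Rightarrow> nat" where
  "edge_multiplicity G u v = card {e \<in> edge_set G. ends G e = {u, v}}"

(* The inserted 0 only matters for graphs with at most one vertex,
   which have no pair of distinct vertices. *)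
definition max_multiplicity :: "('a, 'b) multigraph \<Rightarrow> nat" where
  "max_multiplicity G =
     Max (insert 0 {edge_multiplicity G u v | u v. u \<in> vertices G \<and> v \<in> vertices G \<and> u \<noteq> v})"

definition vertex_degree :: "('a, 'b) multigraph \<Rightarrow> 'a \<Rightarrow> nat" where
  "vertex_degree G v = card {e \<in> edge_set G. v \<in> ends G e}"

definition degree_sequence :: "('a, 'b) multigraph \<Rightarrow> nat list" where
  "degree_sequence G =
     sorted_list_of_multiset (image_mset (vertex_degree G) (mset_set (vertices G)))"

definition multigraph_walk :: "('a, 'b) multigraph \<Rightarrow> 'a list \<Rightarrow> 'b list \<Rightarrow> bool" where
  "multigraph_walk G vs es \<longleftrightarrow>
     length vs = Suc (length es) \<and> set vs \<subseteq> vertices G \<and> set es \<subseteq> edge_set G \<and>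
     (\<forall>i < length es. ends G (es ! i) = {vs ! i, vs ! Suc i})"

definition multigraph_connected :: "('a, 'b) multigraph \<Rightarrow> bool" where
  "multigraph_connected G \<longleftrightarrow>
     vertices G \<noteq> {} \<and>
     (\<forall>u \<in> vertices G. \<forall>v \<in> vertices G.
        \<exists>vs es. multigraph_walk G vs es \<and> hd vs = u \<and> last vs = v)"

(* Two parallel edges form a cycle of length 2; distinctness of the edges
   keeps an edge traversed back and forth from counting as a cycle. *)
definition multigraph_cycle :: "('a, 'b) multigraph \<Rightarrow> 'a list \<Rightarrow> 'b list \<Rightarrow> bool" where
  "multigraph_cycle G vs es \<longleftrightarrow>
     multigraph_walk G vs es \<and> es \<noteq> [] \<and> hd vs = last vs \<and>
     distinct (tl vs) \<and> distinct es"

definition multigraph_tree :: "('a, 'b) multigraph \<Rightarrow> bool" where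
  "multigraph_tree G \<longleftrightarrow>
     multigraph_connected G \<and> (\<nexists>vs es. multigraph_cycle G vs es)"

definition spanning_trees :: "('a, 'b) multigraph \<Rightarrow> 'b set set" where
  "spanning_trees G =
     {F. F \<subseteq> edge_set G \<and> multigraph_tree (G\<lparr>edge_set := F\<rparr>)}"

definition num_spanning_trees :: "('a, 'b) multigraph \<Rightarrow> nat" where
  "num_spanning_trees G = card (spanning_trees G)"

definition complete_multigraph :: "nat \<Rightarrow> ('a, 'b) multigraph \<Rightarrow> bool" where
  "complete_multigraph m G \<longleftrightarrow>
     (\<forall>u \<in> vertices G. \<forall>v \<in> vertices G. u \<noteq> v \<longrightarrow> edge_multiplicity G u v = m)"

end

theory Submission
  imports Defs "Jordan_Normal_Form.Determinant"
begin

text \<open>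
  Let \<open>L\<close> be the Laplacian of \<open>G\<close> and \<open>J\<close> the all-ones matrix. By the matrix-tree theorem
  \<open>det (L + \<Delta> J) = \<Delta> n\<^sup>2 \<tau>(G)\<close>. The matrix \<open>L + \<Delta> J\<close> is positive semidefinite with diagonal
  entries \<open>\<Delta> + d\<^sub>i > 0\<close>, so Hadamard's inequality bounds its determinant by their product, with
  equality iff all off-diagonal entries \<open>\<Delta> - m\<^sub>u\<^sub>v\<close> vanish.

  The matrix-tree theorem is proved for forests rooted at a set \<open>S\<close> of vertices and the principal
  minor of \<open>L\<close> outside of \<open>S\<close>: if an edge \<open>e\<close> joins \<open>s \<in> S\<close> to \<open>u \<notin> S\<close>, then both sides are the
  sum of their values for \<open>E - {e}\<close> with roots \<open>S\<close> and with roots \<open>S \<union> {u}\<close>, so no contraction is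
  needed; if there is no such edge, then both sides are \<open>0\<close>, unless \<open>S\<close> contains all vertices.
\<close>

section \<open>Principal minors\<close>

locale enumeration =
  fixes h :: "nat \<Rightarrow> 'a" and n :: nat and V :: "'a set"
  assumes bij: "bij_betw h {..<n} V"
begin

text \<open>Padding with the identity outside of \<open>U\<close> keeps all principal minors inside \<open>n \<times> n\<close> matrices.\<close>

definition minor_mat :: "'a set \<Rightarrow> ('a \<Rightarrow> 'a \<Rightarrow> real) \<Rightarrow> real mat" where
  "minor_mat U A = mat n n (\<lambda>(i, j).
     if h i \<in> U \<and> h j \<in> U then A (h i) (h j) else if i = j then 1 else 0)"

definition pdet :: "'a set \<Rightarrow> ('a \<Rightarrow> 'a \<Rightarrow> real) \<Rightarrow> real" where
  "pdet U A = det (minor_mat U A)"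

lemma minor_mat_carrier [simp]: "minor_mat U A \<in> carrier_mat n n"
  by (simp add: minor_mat_def)

lemma finite_V: "finite V"
  using bij bij_betw_finite by blast

lemma card_V: "card V = n"
  using bij_betw_same_card[OF bij] by simp

lemma h_in: "i < n \<Longrightarrow> h i \<in> V"
  using bij by (auto simp: bij_betw_def)

lemma h_eq: "i < n \<Longrightarrow> j < n \<Longrightarrow> h i = h j \<longleftrightarrow> i = j"
  using bij by (auto simp: bij_betw_def inj_on_def)

lemma obtain_index:
  assumes "v \<in> V" obtains i where "i < n" "h i = v"
  using assms bij by (auto simp: bij_betw_def)

lemma sum_reindex: "(\<Sum>i<n. f (h i)) = sum f V"
  using sum.reindex_bij_betw[OF bij] .

lemma prod_reindex: "(\<Prod>i<n. f (h i)) = prod f V"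
  using prod.reindex_bij_betw[OF bij] .

lemma pdet_cong:
  assumes "\<And>u v. u \<in> U \<Longrightarrow> v \<in> U \<Longrightarrow> A u v = B u v"
  shows "pdet U A = pdet U B"
proof -
  have "minor_mat U A = minor_mat U B"
    unfolding minor_mat_def by (rule cong_mat) (auto simp: assms)
  then show ?thesis by (simp add: pdet_def)
qed

lemma pdet_empty [simp]: "pdet {} A = 1"
proof -
  have "minor_mat {} A = 1\<^sub>m n"
    by (rule eq_matI) (auto simp: minor_mat_def)
  then show ?thesis by (simp add: pdet_def)
qed

text \<open>Expanding along the row of \<open>u\<close> shows that the determinant is affine in the
  entry at \<open>(u, u)\<close>. Its slope is the cofactor there, which is the minor on
  \<open>U - {u}\<close> because row and column \<open>u\<close> of the padded matrix become those
  of the identity.\<close>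

lemma pdet_add_diag:
  assumes "u \<in> U" "u \<in> V"
  shows "pdet U (\<lambda>v w. A v w + (if v = u \<and> w = u then x else 0)) = pdet U A + x * pdet (U - {u}) A"
proof -
  obtain i where i: "i < n" "h i = u" using assms(2) by (rule obtain_index)
  let ?M = "minor_mat U A" and ?K = "minor_mat (U - {u}) A"
    and ?N = "minor_mat U (\<lambda>v w. A v w + (if v = u \<and> w = u then x else 0))"
  have cof: "cofactor ?N i j = cofactor ?M i j" if "j < n" for j
  proof -
    have "mat_delete ?N i j = mat_delete ?M i j"
      using i that by (auto simp: mat_delete_def minor_mat_def h_eq intro!: cong_mat)
    then show ?thesis by (simp add: cofactor_def)
  qed
  have "mat_delete ?K i i = mat_delete ?M i i"
    using i by (auto simp: mat_delete_def minor_mat_def h_eq intro!: cong_mat)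
  then have cofK: "cofactor ?K i i = cofactor ?M i i" by (simp add: cofactor_def)
  have "det ?K = (\<Sum>j<n. ?K $$ (i, j) * cofactor ?K i j)"
    by (rule laplace_expansion_row) (use i in auto)
  also have "\<dots> = (\<Sum>j<n. if j = i then cofactor ?K i i else 0)"
    by (rule sum.cong) (use i in \<open>auto simp: minor_mat_def\<close>)
  also have "\<dots> = cofactor ?M i i" using i cofK by simp
  finally have K: "det ?K = cofactor ?M i i" .
  have "det ?N = (\<Sum>j<n. ?N $$ (i, j) * cofactor ?N i j)"
    by (rule laplace_expansion_row) (use i in auto)
  also have "\<dots> = (\<Sum>j<n. ?M $$ (i, j) * cofactor ?M i j + (if j = i then x * cofactor ?M i i else 0))"
    by (rule sum.cong) (use i assms cof in \<open>auto simp: minor_mat_def h_eq algebra_simps\<close>)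
  also have "\<dots> = (\<Sum>j<n. ?M $$ (i, j) * cofactor ?M i j) + x * cofactor ?M i i"
    using i by (simp add: sum.distrib)
  also have "(\<Sum>j<n. ?M $$ (i, j) * cofactor ?M i j) = det ?M"
    by (rule laplace_expansion_row[symmetric]) (use i in auto)
  finally show ?thesis using K by (simp add: pdet_def)
qed

lemma sum_index_subset:
  assumes "U \<subseteq> V"
  shows "(\<Sum>j<n. if h j \<in> U then f (h j) else 0) = (\<Sum>v\<in>U. f v)"
  unfolding sum_reindex[of "\<lambda>v. if v \<in> U then f v else 0"]
  by (subst sum.inter_restrict[symmetric]) (use assms finite_V in \<open>auto simp: Int_absorb1\<close>)

text \<open>On the padding indices the matrix acts as the identity, so a kernel vector vanishes
  there and is determined by its values on \<open>U\<close>.\<close>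

lemma pdet_eq_0_iff:
  assumes "U \<subseteq> V"
  shows "pdet U A = 0 \<longleftrightarrow> (\<exists>x. (\<exists>u\<in>U. x u \<noteq> 0) \<and> (\<forall>u\<in>U. (\<Sum>v\<in>U. A u v * x v) = 0))"
    (is "_ \<longleftrightarrow> ?R")
proof -
  let ?M = "minor_mat U A"
  have entry: "(?M *\<^sub>v y) $ i = (if h i \<in> U then (\<Sum>j<n. if h j \<in> U then A (h i) (h j) * y $ j else 0) else y $ i)"
    if "i < n" "y \<in> carrier_vec n" for i y
  proof -
    have "(?M *\<^sub>v y) $ i = (\<Sum>j<n. ?M $$ (i, j) * y $ j)"
      using that by (simp add: minor_mat_def scalar_prod_def lessThan_atLeast0)
    also have "\<dots> = (\<Sum>j<n. if h i \<in> U then (if h j \<in> U then A (h i) (h j) * y $ j else 0)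
        else (if j = i then y $ i else 0))"
      by (rule sum.cong) (use that in \<open>auto simp: minor_mat_def\<close>)
    finally show ?thesis using that by simp
  qed
  have "pdet U A = 0 \<longleftrightarrow> (\<exists>y. y \<in> carrier_vec n \<and> y \<noteq> 0\<^sub>v n \<and> ?M *\<^sub>v y = 0\<^sub>v n)"
    unfolding pdet_def by (rule det_0_iff_vec_prod_zero_field) simp
  also have "\<dots> \<longleftrightarrow> ?R"
  proof
    assume "\<exists>y. y \<in> carrier_vec n \<and> y \<noteq> 0\<^sub>v n \<and> ?M *\<^sub>v y = 0\<^sub>v n"
    then obtain y where y: "y \<in> carrier_vec n" "y \<noteq> 0\<^sub>v n" "?M *\<^sub>v y = 0\<^sub>v n" by blast
    define x where "x v = y $ (the_inv_into {..<n} h v)" for v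
    have xh: "x (h i) = y $ i" if "i < n" for i
      using that bij by (simp add: x_def the_inv_into_f_f bij_betw_def)
    have z: "(if h i \<in> U then (\<Sum>j<n. if h j \<in> U then A (h i) (h j) * y $ j else 0) else y $ i) = 0"
      if "i < n" for i
      using entry[OF that y(1)] y(3) that by simp
    have "\<exists>i<n. y $ i \<noteq> 0"
    proof (rule ccontr)
      assume "\<not> (\<exists>i<n. y $ i \<noteq> 0)"
      then have "y = 0\<^sub>v n" using y(1) by (intro eq_vecI) auto
      then show False using y(2) by simp
    qed
    then obtain i where i: "i < n" "y $ i \<noteq> 0" by blast
    then have "h i \<in> U" using z[OF i(1)] by (auto split: if_splits)
    then have "\<exists>u\<in>U. x u \<noteq> 0" using xh[OF i(1)] i(2) by (intro bexI[of _ "h i"]) simp_all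
    moreover have "(\<Sum>v\<in>U. A u v * x v) = 0" if u: "u \<in> U" for u
    proof -
      obtain i where i: "i < n" "h i = u" using u assms obtain_index by blast
      have "(\<Sum>v\<in>U. A u v * x v) = (\<Sum>j<n. if h j \<in> U then A u (h j) * x (h j) else 0)"
        using sum_index_subset[OF assms, of "\<lambda>v. A u v * x v"] by simp
      also have "\<dots> = (\<Sum>j<n. if h j \<in> U then A u (h j) * y $ j else 0)"
        by (rule sum.cong) (auto simp: xh)
      also have "\<dots> = 0" using z[OF i(1)] u unfolding i(2) by simp
      finally show ?thesis .
    qed
    ultimately show ?R by blast
  next
    assume ?R
    then obtain x where x: "\<exists>u\<in>U. x u \<noteq> 0" "\<forall>u\<in>U. (\<Sum>v\<in>U. A u v * x v) = 0" by blast
    define y where "y = vec n (\<lambda>i. if h i \<in> U then x (h i) else 0)"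
    have y: "y \<in> carrier_vec n" by (simp add: y_def)
    have "y \<noteq> 0\<^sub>v n"
    proof
      assume y0: "y = 0\<^sub>v n"
      obtain u where u: "u \<in> U" "x u \<noteq> 0" using x by blast
      then obtain i where i: "i < n" "h i = u" using assms obtain_index by blast
      have "y $ i = x u" using i u by (simp add: y_def)
      then show False using y0 i u by simp
    qed
    moreover have "?M *\<^sub>v y = 0\<^sub>v n"
    proof (rule eq_vecI)
      fix i assume "i < dim_vec (0\<^sub>v n :: real vec)"
      then have i: "i < n" by simp
      have "(\<Sum>j<n. if h j \<in> U then A (h i) (h j) * y $ j else 0) = (\<Sum>v\<in>U. A (h i) v * x v)"
        unfolding sum_index_subset[OF assms, of "\<lambda>v. A (h i) v * x v", symmetric]
        by (rule sum.cong) (auto simp: y_def)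
      then show "(?M *\<^sub>v y) $ i = 0\<^sub>v n $ i"
        unfolding entry[OF i y] using i x(2) by (auto simp: y_def)
    qed (simp add: minor_mat_def)
    ultimately show "\<exists>y. y \<in> carrier_vec n \<and> y \<noteq> 0\<^sub>v n \<and> ?M *\<^sub>v y = 0\<^sub>v n" using y by blast
  qed
  finally show ?thesis .
qed

lemma pdet_lower_triangular:
  assumes "\<And>i j. i < j \<Longrightarrow> j < n \<Longrightarrow> A (h i) (h j) = 0" and U: "U \<subseteq> V"
  shows "pdet U A = (\<Prod>v\<in>U. A v v)"
proof -
  let ?f = "\<lambda>v. if v \<in> U then A v v else 1"
  have "pdet U A = prod_list (diag_mat (minor_mat U A))"
    unfolding pdet_def by (rule det_lower_triangular[of n]) (use assms(1) in \<open>auto simp: minor_mat_def\<close>)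
  also have "\<dots> = (\<Prod>i<n. ?f (h i))"
    unfolding prod_list_diag_prod by (rule prod.cong) (auto simp: minor_mat_def)
  also have "\<dots> = prod ?f V" by (rule prod_reindex)
  also have "\<dots> = (\<Prod>v\<in>U. A v v)"
    by (subst prod.inter_restrict[symmetric]) (use U finite_V in \<open>auto simp: Int_absorb1\<close>)
  finally show ?thesis .
qed

lemma pdet_transpose: "pdet U (\<lambda>u v. A v u) = pdet U A"
proof -
  have "minor_mat U (\<lambda>u v. A v u) = transpose_mat (minor_mat U A)"
    by (rule eq_matI) (auto simp: minor_mat_def)
  then show ?thesis by (simp add: pdet_def det_transpose[of _ n])
qed

lemma pdet_mult: "pdet V (\<lambda>u w. \<Sum>v\<in>V. A u v * B v w) = pdet V A * pdet V B"
proof -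
  have "minor_mat V (\<lambda>u w. \<Sum>v\<in>V. A u v * B v w) = minor_mat V A * minor_mat V B"
    by (rule eq_matI)
      (auto simp: minor_mat_def scalar_prod_def h_in sum_reindex[symmetric] lessThan_atLeast0 intro!: sum.cong)
  then show ?thesis by (simp add: pdet_def det_mult[of _ n])
qed

text \<open>
  With \<open>S = I + w 1\<^sup>T\<close> and \<open>w = 1 - e\<^sub>r\<close> one has \<open>S (A + x e\<^sub>r e\<^sub>r\<^sup>T) S\<^sup>T = A + x 1 1\<^sup>T\<close>.
  The triangular matrices \<open>P\<close> and \<open>T\<close> satisfy \<open>P S = T P\<close>, which gives \<open>det S = n\<close>.
\<close>

lemma pdet_add_const:
  assumes n: "n > 0"
    and rows: "\<And>u. u \<in> V \<Longrightarrow> (\<Sum>v\<in>V. A u v) = 0"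
    and cols: "\<And>v. v \<in> V \<Longrightarrow> (\<Sum>u\<in>V. A u v) = 0"
  shows "pdet V (\<lambda>u v. A u v + x) = x * (real n)\<^sup>2 * pdet (V - {h 0}) A"
proof -
  define r where "r = h 0"
  have r: "r \<in> V" using n h_in by (simp add: r_def)
  define P :: "'a \<Rightarrow> 'a \<Rightarrow> real" where "P u v = (if u = r \<or> v = u then 1 else 0)" for u v
  define T :: "'a \<Rightarrow> 'a \<Rightarrow> real" where
    "T u v = (if u = r then (if v = r then real n else 0) else (if v = r then 1 else 0) + (if v = u then 1 else 0))" for u v
  define S :: "'a \<Rightarrow> 'a \<Rightarrow> real" where "S u v = (if v = u then 1 else 0) + (if u = r then 0 else 1)" for u v
  define B where "B u v = A u v + (if u = r \<and> v = r then x else 0)" for u v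
  note [simp] = finite_V
  have delta: "(\<Sum>v\<in>V. (if v = u then f v else 0)) = f u" if "u \<in> V" for u and f :: "'a \<Rightarrow> real"
    using that by simp
  \<comment> \<open>As \<open>r\<close> is first in the enumeration, \<open>P\<close> is upper
    triangular with unit diagonal, and \<open>T\<close> is lower triangular with diagonal
    \<open>n, 1, ..., 1\<close>.\<close>
  have "pdet V (\<lambda>u v. P v u) = (\<Prod>v\<in>V. P v v)"
    by (rule pdet_lower_triangular) (auto simp: P_def r_def h_eq)
  then have detP: "pdet V P = 1" unfolding pdet_transpose[of V P] by (simp add: P_def[of v v for v])
  have "pdet V T = (\<Prod>v\<in>V. T v v)"
    by (rule pdet_lower_triangular) (auto simp: T_def r_def h_eq)
  also have "\<dots> = (\<Prod>v\<in>V. if v = r then real n else 1)"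
    by (rule prod.cong) (auto simp: T_def)
  finally have detT: "pdet V T = real n" using r by simp
  have "(\<Sum>v\<in>V. P u v * S v w) = (\<Sum>v\<in>V. T u v * P v w)" if uw: "u \<in> V" "w \<in> V" for u w
  proof (cases "u = r")
    case True
    have "(\<Sum>v\<in>V. P u v * S v w) = (\<Sum>v\<in>V. (if v = w then 1 else 0) + (1 - (if v = r then 1 else 0)))"
      by (rule sum.cong) (auto simp: P_def S_def True)
    also have "\<dots> = real n" using r uw by (simp add: sum.distrib sum_subtractf card_V)
    also have "\<dots> = (\<Sum>v\<in>V. if v = r then real n else 0)" using r by simp
    also have "\<dots> = (\<Sum>v\<in>V. T u v * P v w)"
      by (rule sum.cong) (auto simp: P_def T_def True)
    finally show ?thesis .
  next
    case False
    have "(\<Sum>v\<in>V. P u v * S v w) = (\<Sum>v\<in>V. if v = u then S v w else 0)"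
      by (rule sum.cong) (auto simp: P_def False)
    also have "\<dots> = (\<Sum>v\<in>V. (if v = r then 1 else 0) + (if v = u then P u w else 0))"
      using uw r False by (simp add: sum.distrib S_def P_def)
    also have "\<dots> = (\<Sum>v\<in>V. T u v * P v w)"
      by (rule sum.cong) (auto simp: T_def P_def False)
    finally show ?thesis .
  qed
  then have "pdet V (\<lambda>u w. \<Sum>v\<in>V. P u v * S v w) = pdet V (\<lambda>u w. \<Sum>v\<in>V. T u v * P v w)"
    by (rule pdet_cong)
  then have detS: "pdet V S = real n" unfolding pdet_mult detP detT by simp
  \<comment> \<open>Multiplying by \<open>S\<close> from the left adds the column sums of
    \<open>B\<close> to every row except \<open>r\<close>. Those of \<open>A\<close> vanish, so only
    the \<open>x\<close> in column \<open>r\<close> spreads. Multiplying by the transpose of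
    \<open>S\<close> then spreads it to the other columns in the same way.\<close>
  have SB: "(\<Sum>v\<in>V. S u v * B v w) = A u w + (if w = r then x else 0)" if uw: "u \<in> V" "w \<in> V" for u w
  proof -
    have "(\<Sum>v\<in>V. B v w) = (\<Sum>v\<in>V. A v w + (if v = r then if w = r then x else 0 else 0))"
      by (rule sum.cong) (auto simp: B_def)
    then have "(\<Sum>v\<in>V. B v w) = (if w = r then x else 0)"
      using cols[OF uw(2)] r by (simp add: sum.distrib)
    moreover have "(\<Sum>v\<in>V. S u v * B v w)
        = (\<Sum>v\<in>V. (if v = u then B u w else 0) + (if u = r then 0 else 1) * B v w)"
      by (rule sum.cong) (auto simp: S_def algebra_simps)
    ultimately show ?thesis
      using uw by (simp add: sum.distrib sum_distrib_left[symmetric] B_def)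
  qed
  have SBS: "(\<Sum>v\<in>V. (\<Sum>v'\<in>V. S u v' * B v' v) * S w v) = A u w + x" if uw: "u \<in> V" "w \<in> V" for u w
  proof -
    have "(\<Sum>v\<in>V. (\<Sum>v'\<in>V. S u v' * B v' v) * S w v)
        = (\<Sum>v\<in>V. (A u v + (if v = r then x else 0)) * S w v)"
      by (rule sum.cong) (use uw SB in auto)
    also have "\<dots> = (\<Sum>v\<in>V. (if v = w then A u w + (if w = r then x else 0) else 0)
        + (if w = r then 0 else 1) * (A u v + (if v = r then x else 0)))"
      by (rule sum.cong) (auto simp: S_def algebra_simps)
    also have "\<dots> = A u w + (if w = r then x else 0) + (if w = r then 0 else 1) * x"
      using uw r rows[OF uw(1)] by (simp add: sum.distrib sum_distrib_left[symmetric])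
    finally show ?thesis by simp
  qed
  have "pdet V (\<lambda>u v. A u v + x) = pdet V (\<lambda>u w. \<Sum>v\<in>V. (\<Sum>v'\<in>V. S u v' * B v' v) * S w v)"
    by (rule pdet_cong) (simp add: SBS)
  also have "\<dots> = pdet V (\<lambda>u w. \<Sum>v'\<in>V. S u v' * B v' w) * pdet V (\<lambda>v w. S w v)"
    by (rule pdet_mult)
  also have "\<dots> = (real n)\<^sup>2 * pdet V B"
    unfolding pdet_mult pdet_transpose[of V S] detS by (simp add: power2_eq_square)
  also have "pdet V B = pdet V A + x * pdet (V - {r}) A"
    unfolding B_def by (rule pdet_add_diag) (use r in auto)
  \<comment> \<open>The all-ones vector lies in the kernel of \<open>A\<close>, so only the term
    with \<open>V - {r}\<close> remains.\<close>
  also have "pdet V A = 0"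
    unfolding pdet_eq_0_iff[OF subset_refl] using r rows by (intro exI[of _ "\<lambda>_. 1"]) auto
  finally show ?thesis by (simp add: r_def)
qed

end

section \<open>Hadamard's inequality\<close>

definition bilinear_on :: "'a set \<Rightarrow> ('a \<Rightarrow> 'a \<Rightarrow> real) \<Rightarrow> ('a \<Rightarrow> real) \<Rightarrow> ('a \<Rightarrow> real) \<Rightarrow> real" where
  "bilinear_on U A x y = (\<Sum>u\<in>U. x u * (\<Sum>v\<in>U. A u v * y v))"

text \<open>Symmetry is demanded separately, since over the reals it does not follow from
  nonnegativity of the form.\<close>

definition psd_on :: "'a set \<Rightarrow> ('a \<Rightarrow> 'a \<Rightarrow> real) \<Rightarrow> bool" where
  "psd_on U A \<longleftrightarrow> (\<forall>u\<in>U. \<forall>v\<in>U. A u v = A v u) \<and> (\<forall>x. bilinear_on U A x x \<ge> 0)"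

lemma bilinear_on_add_left:
  "bilinear_on U A (\<lambda>u. a * x u + b * y u) z = a * bilinear_on U A x z + b * bilinear_on U A y z"
  by (simp add: bilinear_on_def algebra_simps sum.distrib sum_distrib_left)

lemma bilinear_on_commute:
  assumes "\<forall>u\<in>U. \<forall>v\<in>U. A u v = A v u"
  shows "bilinear_on U A x y = bilinear_on U A y x"
proof -
  have "bilinear_on U A x y = (\<Sum>v\<in>U. \<Sum>u\<in>U. x u * (A u v * y v))"
    unfolding bilinear_on_def sum_distrib_left by (rule sum.swap)
  also have "\<dots> = bilinear_on U A y x"
    unfolding bilinear_on_def sum_distrib_left
    by (intro sum.cong) (use assms in \<open>auto simp: mult_ac\<close>)
  finally show ?thesis .
qed

lemma bilinear_on_delta:
  assumes "finite U" "k \<in> U"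
  shows "bilinear_on U A (\<lambda>u. if u = k then 1 else 0) y = (\<Sum>v\<in>U. A k v * y v)"
proof -
  have "bilinear_on U A (\<lambda>u. if u = k then 1 else 0) y = (\<Sum>u\<in>U. if u = k then \<Sum>v\<in>U. A k v * y v else 0)"
    unfolding bilinear_on_def by (rule sum.cong) auto
  then show ?thesis using assms by simp
qed

lemma bilinear_on_quadratic:
  assumes "\<forall>u\<in>U. \<forall>v\<in>U. A u v = A v u"
  shows "bilinear_on U A (\<lambda>u. a * x u + b * y u) (\<lambda>u. a * x u + b * y u)
    = a\<^sup>2 * bilinear_on U A x x + 2 * a * b * bilinear_on U A x y + b\<^sup>2 * bilinear_on U A y y"
  unfolding bilinear_on_add_left
  by (simp add: bilinear_on_commute[OF assms, of _ "\<lambda>u. a * x u + b * y u"] bilinear_on_add_left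
      bilinear_on_commute[OF assms, of y x] power2_eq_square algebra_simps)

text \<open>At \<open>e_k + t x\<close> the form is affine in \<open>t\<close> with slope
  \<open>2 (A x)_k\<close>; with a nonzero slope it would take negative values.\<close>

lemma psd_on_null_vector:
  assumes psd: "psd_on U A" and U: "finite U" "k \<in> U" and null: "bilinear_on U A x x = 0"
  shows "(\<Sum>v\<in>U. A k v * x v) = 0"
proof (rule ccontr)
  let ?e = "\<lambda>u. if u = k then 1 else (0 :: real)"
  let ?s = "\<Sum>v\<in>U. A k v * x v" and ?c = "bilinear_on U A ?e ?e"
  assume s: "?s \<noteq> 0"
  have sym: "\<forall>u\<in>U. \<forall>v\<in>U. A u v = A v u" using psd unfolding psd_on_def by blast
  have c: "?c \<ge> 0" using psd unfolding psd_on_def by blast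
  \<comment> \<open>The value of the form below is affine in \<open>t\<close>; this choice makes it
    \<open>-1\<close>.\<close>
  define t where "t = - (?c + 1) / (2 * ?s)"
  have "0 \<le> bilinear_on U A (\<lambda>u. 1 * ?e u + t * x u) (\<lambda>u. 1 * ?e u + t * x u)"
    using psd unfolding psd_on_def by blast
  also have "\<dots> = ?c + 2 * t * ?s"
    unfolding bilinear_on_quadratic[OF sym] null bilinear_on_delta[OF U] by simp
  also have "\<dots> = - 1" using s by (simp add: t_def field_simps)
  finally show False by simp
qed

text \<open>Extension by zero carries semidefiniteness down to \<open>U\<close> and null vectors up
  to \<open>insert k U\<close>.\<close>

lemma bilinear_on_insert_zero:
  assumes "finite U" "k \<notin> U"
  shows "bilinear_on (insert k U) A (x(k := 0)) (x(k := 0)) = bilinear_on U A x x"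
proof -
  have "(\<Sum>v\<in>insert k U. A u v * (x(k := 0)) v) = (\<Sum>v\<in>U. A u v * x v)" for u
  proof -
    have "(\<Sum>v\<in>U. A u v * (x(k := 0)) v) = (\<Sum>v\<in>U. A u v * x v)"
      by (rule sum.cong) (use assms in auto)
    then show ?thesis using assms by simp
  qed
  then have "bilinear_on (insert k U) A (x(k := 0)) (x(k := 0))
      = (\<Sum>u\<in>U. (x(k := 0)) u * (\<Sum>v\<in>U. A u v * x v))"
    using assms by (simp add: bilinear_on_def)
  also have "\<dots> = bilinear_on U A x x"
    unfolding bilinear_on_def by (rule sum.cong) (use assms in auto)
  finally show ?thesis .
qed

lemma psd_on_insertD:
  assumes "psd_on (insert k U) A" "finite U" "k \<notin> U"
  shows "psd_on U A"
  unfolding psd_on_def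
proof (intro conjI allI)
  show "\<forall>u\<in>U. \<forall>v\<in>U. A u v = A v u" using assms(1) by (simp add: psd_on_def)
  fix x show "0 \<le> bilinear_on U A x x"
    using assms(1) unfolding bilinear_on_insert_zero[OF assms(2,3), of A x, symmetric] psd_on_def by blast
qed

section \<open>Hadamard's inequality with its equality case\<close>

context enumeration
begin

lemma pdet_diagonal:
  assumes "U \<subseteq> V" "\<And>u v. u \<in> U \<Longrightarrow> v \<in> U \<Longrightarrow> u \<noteq> v \<Longrightarrow> A u v = 0"
  shows "pdet U A = (\<Prod>v\<in>U. A v v)"
proof -
  \<comment> \<open>\<open>pdet_lower_triangular\<close> asks for zeros above the diagonal on all of
    \<open>V\<close>, so the off-diagonal entries outside \<open>U\<close> are cleared
    first.\<close>
  have "pdet U A = pdet U (\<lambda>u v. if u = v then A u v else 0)"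
    by (rule pdet_cong) (use assms in auto)
  also have "\<dots> = (\<Prod>v\<in>U. if v = v then A v v else 0)"
    by (rule pdet_lower_triangular) (use assms(1) in \<open>auto simp: h_eq\<close>)
  finally show ?thesis by simp
qed

text \<open>
  In the induction step, subtracting \<open>x\<^sub>0 = pdet (insert k U) A / pdet U A\<close> from the diagonal entry
  at \<open>k\<close> makes the determinant vanish. A kernel vector \<open>v\<close> with \<open>v k = 1\<close> has
  \<open>v\<^sup>T A v = x\<^sub>0\<close>, and \<open>w = e\<^sub>k - v\<close> has \<open>w\<^sup>T A w = A k k - x\<^sub>0 \<ge> 0\<close>.
\<close>

lemma hadamard_inequality:
  assumes "finite U" "U \<subseteq> V" "psd_on U A" "\<And>u. u \<in> U \<Longrightarrow> A u u > 0"
  shows "0 \<le> pdet U A \<and> pdet U A \<le> (\<Prod>u\<in>U. A u u) \<and>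
    (pdet U A = (\<Prod>u\<in>U. A u u) \<longrightarrow> (\<forall>u\<in>U. \<forall>v\<in>U. u \<noteq> v \<longrightarrow> A u v = 0))"
  using assms
proof (induction U rule: finite_induct)
  case empty
  show ?case by simp
next
  case (insert k U)
  let ?W = "insert k U" and ?P = "\<Prod>u\<in>U. A u u"
  have fin: "finite ?W" "k \<in> ?W" using insert.hyps by auto
  have sym: "\<forall>u\<in>?W. \<forall>v\<in>?W. A u v = A v u" using insert.prems(2) unfolding psd_on_def by blast
  have nonneg: "bilinear_on ?W A x x \<ge> 0" for x using insert.prems(2) unfolding psd_on_def by blast
  note null = psd_on_null_vector[OF insert.prems(2) fin(1)]
  have IH: "0 \<le> pdet U A" "pdet U A \<le> ?P"
      "pdet U A = ?P \<longrightarrow> (\<forall>u\<in>U. \<forall>v\<in>U. u \<noteq> v \<longrightarrow> A u v = 0)"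
    using insert.IH psd_on_insertD[OF insert.prems(2) insert.hyps] insert.prems by auto
  have prod_pos: "?P > 0" using insert.prems by (intro prod_pos) auto
  have Akk: "A k k > 0" using insert.prems by simp
  have prodW: "(\<Prod>u\<in>?W. A u u) = A k k * ?P" using insert.hyps by simp
  show ?case
  proof (cases "pdet U A = 0")
    case True
    \<comment> \<open>A kernel vector on \<open>U\<close>, extended by \<open>0\<close> at
      \<open>k\<close>, is a null vector of the form on \<open>?W\<close> and hence in the kernel
      there. The determinant stays \<open>0\<close>, strictly below the product, so equality cannot
      occur.\<close>
    then obtain x where x: "\<exists>u\<in>U. x u \<noteq> 0" "\<forall>u\<in>U. (\<Sum>v\<in>U. A u v * x v) = 0"
      using pdet_eq_0_iff[of U A] insert.prems(1) by blast
    have "bilinear_on ?W A (x(k := 0)) (x(k := 0)) = 0"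
      unfolding bilinear_on_insert_zero[OF insert.hyps] using x(2) by (simp add: bilinear_on_def)
    then have "\<forall>u\<in>?W. (\<Sum>v\<in>?W. A u v * (x(k := 0)) v) = 0" using null by blast
    moreover have "\<exists>u\<in>?W. (x(k := 0)) u \<noteq> 0" using x(1) insert.hyps by auto
    ultimately have "pdet ?W A = 0" using pdet_eq_0_iff[OF insert.prems(1)] by blast
    moreover have "A k k * ?P > 0" using Akk prod_pos by simp
    ultimately show ?thesis unfolding prodW by (intro conjI impI) auto
  next
    case False
    then have posU: "pdet U A > 0" using IH by simp
    define x0 where "x0 = pdet ?W A / pdet U A"
    let ?B = "\<lambda>v w. A v w + (if v = k \<and> w = k then - x0 else 0)"
    let ?e = "\<lambda>u. if u = k then 1 else (0 :: real)"
    have "pdet ?W ?B = pdet ?W A + (- x0) * pdet (?W - {k}) A"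
      by (rule pdet_add_diag) (use insert.prems in auto)
    also have "?W - {k} = U" using insert.hyps by auto
    finally have "pdet ?W ?B = 0" using posU by (simp add: x0_def)
    from iffD1[OF pdet_eq_0_iff[OF insert.prems(1)] this]
    obtain x where x: "\<exists>u\<in>?W. x u \<noteq> 0" "\<forall>u\<in>?W. (\<Sum>v\<in>?W. ?B u v * x v) = 0"
      by blast
    have Ax: "(\<Sum>v\<in>?W. A u v * x v) = (if u = k then x0 * x k else 0)" if "u \<in> ?W" for u
    proof -
      have "(\<Sum>v\<in>?W. ?B u v * x v) = (\<Sum>v\<in>?W. A u v * x v + (if v = k then (if u = k then - x0 * x k else 0) else 0))"
        by (rule sum.cong) (auto simp: algebra_simps)
      also have "\<dots> = (\<Sum>v\<in>?W. A u v * x v) + (if u = k then - x0 * x k else 0)"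
        using fin by (simp add: sum.distrib)
      finally show ?thesis using x(2) that by auto
    qed
    \<comment> \<open>If \<open>x k\<close> were \<open>0\<close>, then \<open>x\<close> would give
      a nonzero kernel vector on \<open>U\<close>, against \<open>pdet U A \<noteq> 0\<close>. This
      permits scaling to \<open>v k = 1\<close>.\<close>
    have xk: "x k \<noteq> 0"
    proof
      assume xk: "x k = 0"
      have "(\<Sum>v\<in>U. A u v * x v) = 0" if "u \<in> U" for u
        using Ax[of u] that insert.hyps xk by auto
      moreover have "\<exists>u\<in>U. x u \<noteq> 0" using x(1) xk by auto
      moreover have "U \<subseteq> V" using insert.prems(1) by simp
      ultimately have "pdet U A = 0" by (intro iffD2[OF pdet_eq_0_iff]) auto
      then show False using False by simp
    qed
    define v where "v u = x u / x k" for u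
    have Av: "(\<Sum>w\<in>?W. A u w * v w) = (if u = k then x0 else 0)" if "u \<in> ?W" for u
    proof -
      have "(\<Sum>w\<in>?W. A u w * v w) = (\<Sum>w\<in>?W. A u w * x w) / x k"
        unfolding sum_divide_distrib by (simp add: v_def)
      then show ?thesis using Ax[OF that] xk by simp
    qed
    have vk: "v k = 1" using xk by (simp add: v_def)
    have vv: "bilinear_on ?W A v v = x0"
    proof -
      have "bilinear_on ?W A v v = (\<Sum>u\<in>?W. if u = k then x0 else 0)"
        unfolding bilinear_on_def by (rule sum.cong) (auto simp: Av vk)
      then show ?thesis using fin by simp
    qed
    \<comment> \<open>The coefficients \<open>1\<close> and \<open>- 1\<close> are spelled out so
      that \<open>bilinear_on_quadratic\<close> applies.\<close>
    let ?w = "\<lambda>u. 1 * ?e u + (- 1) * v u"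
    have Ae: "(\<Sum>w\<in>?W. A u w * ?e w) = A u k" for u
    proof -
      have "(\<Sum>w\<in>?W. A u w * ?e w) = (\<Sum>w\<in>?W. if w = k then A u k else 0)"
        by (rule sum.cong) auto
      then show ?thesis using fin by simp
    qed
    have ww: "bilinear_on ?W A ?w ?w = A k k - x0"
      unfolding bilinear_on_quadratic[OF sym] vv bilinear_on_delta[OF fin] Av[OF fin(2)] Ae by simp
    have x0: "0 \<le> x0" "x0 \<le> A k k" using nonneg[of v] nonneg[of ?w] vv ww by auto
    have W: "pdet ?W A = x0 * pdet U A" using posU by (simp add: x0_def)
    have le: "x0 * pdet U A \<le> A k k * ?P"
      using x0 IH posU Akk by (intro mult_mono) auto
    \<comment> \<open>Equality forces both \<open>pdet U A = ?P\<close> and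
      \<open>x0 = A k k\<close>. The first settles the entries within \<open>U\<close> by induction.
      The second makes \<open>?w\<close> a null vector, so \<open>A ?w = 0\<close>; its entry at
      \<open>u\<close> is \<open>A u k\<close>, since \<open>A v\<close> vanishes off
      \<open>k\<close>.\<close>
    have diag: "\<forall>u\<in>?W. \<forall>v\<in>?W. u \<noteq> v \<longrightarrow> A u v = 0" if eq: "x0 * pdet U A = A k k * ?P"
    proof -
      have "x0 * pdet U A \<le> A k k * pdet U A" using x0 posU by simp
      moreover have "A k k * pdet U A \<le> A k k * ?P" using IH Akk by simp
      ultimately have "A k k * pdet U A = A k k * ?P" "x0 * pdet U A = A k k * pdet U A"
        using eq by linarith+
      then have e: "pdet U A = ?P" "x0 = A k k" using Akk posU by auto
      have Auk: "A u k = 0" if u: "u \<in> U" for u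
      proof -
        have "0 = (\<Sum>w\<in>?W. A u w * ?w w)" using null[of u ?w] ww e u by simp
        also have "\<dots> = (\<Sum>w\<in>?W. A u w * ?e w) - (\<Sum>w\<in>?W. A u w * v w)"
          by (simp only: sum_subtractf[symmetric]) (simp add: algebra_simps)
        also have "\<dots> = A u k" using Ae Av[of u] u insert.hyps by auto
        finally show ?thesis by simp
      qed
      show ?thesis
      proof (intro ballI impI)
        fix u v assume uv: "u \<in> ?W" "v \<in> ?W" "u \<noteq> v"
        then consider "u \<in> U" "v \<in> U" | "u = k" "v \<in> U" | "u \<in> U" "v = k" by blast
        then show "A u v = 0"
        proof cases
          case 1
          then show ?thesis using IH(3) e(1) uv(3) by blast
        next
          case 2
          have "A u v = A v u" using sym uv by blast
          then show ?thesis using Auk[of v] 2 by simp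
        next
          case 3
          then show ?thesis using Auk[of u] by simp
        qed
      qed
    qed
    have "0 \<le> x0 * pdet U A" using x0(1) posU by simp
    then show ?thesis unfolding W prodW using le diag by blast
  qed
qed

lemma hadamard_eq_iff:
  assumes "U \<subseteq> V" "psd_on U A" "\<And>u. u \<in> U \<Longrightarrow> A u u > 0"
  shows "pdet U A = (\<Prod>u\<in>U. A u u) \<longleftrightarrow> (\<forall>u\<in>U. \<forall>v\<in>U. u \<noteq> v \<longrightarrow> A u v = 0)"
  using hadamard_inequality[OF finite_subset[OF assms(1) finite_V] assms] pdet_diagonal[OF assms(1)]
  by blast

end

section \<open>Spanning trees and rooted forests\<close>

text \<open>Taking an end function and an edge set instead of a multigraph lets edges be removed
  freely.\<close>

definition adj :: "('b \<Rightarrow> 'a set) \<Rightarrow> 'b set \<Rightarrow> ('a \<times> 'a) set" where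
  "adj g F = {(x, y). \<exists>e\<in>F. g e = {x, y}}"

lemma sym_adj_rtrancl: "(x, y) \<in> (adj g F)\<^sup>* \<Longrightarrow> (y, x) \<in> (adj g F)\<^sup>*"
proof -
  have "sym (adj g F)" by (auto simp: sym_def adj_def insert_commute)
  then show "(x, y) \<in> (adj g F)\<^sup>* \<Longrightarrow> (y, x) \<in> (adj g F)\<^sup>*"
    by (meson sym_rtrancl symD)
qed

lemma adj_mono: "F \<subseteq> F' \<Longrightarrow> adj g F \<subseteq> adj g F'"
  by (auto simp: adj_def)

lemma adj_rtrancl_mono: "F \<subseteq> F' \<Longrightarrow> (adj g F)\<^sup>* \<subseteq> (adj g F')\<^sup>*"
  by (intro rtrancl_mono adj_mono)

text \<open>Making \<open>u\<close> a root replaces contracting \<open>e\<close>: a path that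
  crosses \<open>e\<close> arrives at \<open>s\<close> or \<open>u\<close>, both of which are roots,
  and can be restarted there without \<open>e\<close>.\<close>

lemma reachable_remove_boundary_edge:
  assumes "e \<in> F" "g e = {s, u}" "s \<in> S"
  shows "(adj g F)\<^sup>* `` S = (adj g (F - {e}))\<^sup>* `` insert u S"
proof
  show "(adj g F)\<^sup>* `` S \<subseteq> (adj g (F - {e}))\<^sup>* `` insert u S"
  proof
    fix y assume "y \<in> (adj g F)\<^sup>* `` S"
    then obtain x where "x \<in> S" "(x, y) \<in> (adj g F)\<^sup>*" by blast
    from this(2,1) show "y \<in> (adj g (F - {e}))\<^sup>* `` insert u S"
    proof (induction rule: rtrancl_induct)
      case base
      then show ?case by blast
    next
      case (step y z)
      then obtain x where x: "x \<in> insert u S" "(x, y) \<in> (adj g (F - {e}))\<^sup>*" by blast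
      obtain e' where e': "e' \<in> F" "g e' = {y, z}" using step.hyps by (auto simp: adj_def)
      show ?case
      proof (cases "e' = e")
        case True
        then have "z \<in> insert u S" using e' assms by (auto simp: doubleton_eq_iff)
        then show ?thesis by blast
      next
        case False
        then have "(y, z) \<in> adj g (F - {e})" using e' by (auto simp: adj_def)
        then show ?thesis using x by (meson Image_iff rtrancl.rtrancl_into_rtrancl)
      qed
    qed
  qed
next
  have "(s, u) \<in> adj g F" using assms by (auto simp: adj_def)
  moreover have "(adj g (F - {e}))\<^sup>* \<subseteq> (adj g F)\<^sup>*" by (rule adj_rtrancl_mono) auto
  ultimately show "(adj g (F - {e}))\<^sup>* `` insert u S \<subseteq> (adj g F)\<^sup>* `` S"
    using assms(3) by (auto intro: converse_rtrancl_into_rtrancl)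
qed

text \<open>Otherwise \<open>S\<close> is closed under adjacency and reaches only itself.\<close>

lemma ex_boundary_edge:
  assumes "V \<subseteq> (adj g F)\<^sup>* `` S" "\<not> V \<subseteq> S"
  shows "\<exists>e\<in>F. \<exists>s\<in>S. \<exists>u. u \<notin> S \<and> g e = {s, u}"
proof (rule ccontr)
  assume "\<not> ?thesis"
  then have "adj g F `` S \<subseteq> S" by (auto simp: adj_def)
  then have "(adj g F)\<^sup>* `` S = S" by (rule Image_closed_trancl)
  then show False using assms by simp
qed

text \<open>Each selected boundary edge turns its outer end into a new root, so exactly one edge is
  spent per non-root vertex. The result also shows that reaching \<open>V\<close> takes at least
  \<open>card (V - S)\<close> edges.\<close>

lemma ex_rooted_forest:
  assumes "finite V" "finite F" "\<forall>e\<in>F. g e \<subseteq> V" "V \<subseteq> (adj g F)\<^sup>* `` S"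
  shows "\<exists>F'\<subseteq>F. card F' = card (V - S) \<and> V \<subseteq> (adj g F')\<^sup>* `` S"
  using assms
proof (induction "card (V - S)" arbitrary: F S)
  case 0
  then have "V \<subseteq> S" by simp
  then show ?case using 0 by (intro exI[of _ "{}"]) auto
next
  case (Suc k)
  then have "\<not> V \<subseteq> S" by (metis Diff_eq_empty_iff card.empty nat.distinct(1))
  then obtain e s u where e: "e \<in> F" "s \<in> S" "u \<notin> S" "g e = {s, u}"
    using ex_boundary_edge[OF Suc.prems(4)] by blast
  have u: "u \<in> V" using e Suc.prems(3) by auto
  have "V - S = insert u (V - insert u S)" using u e(3) by auto
  then have card: "card (V - S) = Suc (card (V - insert u S))"
    using Suc.prems(1) by (metis card_insert_disjoint Diff_iff finite_Diff insertI1)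
  have "\<exists>F'\<subseteq>F - {e}. card F' = card (V - insert u S) \<and> V \<subseteq> (adj g F')\<^sup>* `` insert u S"
  proof (rule Suc.hyps(1))
    show "k = card (V - insert u S)" using card Suc.hyps(2) by simp
    show "V \<subseteq> (adj g (F - {e}))\<^sup>* `` insert u S"
      using reachable_remove_boundary_edge[of e F g s u S] e Suc.prems(4) by simp
  qed (use Suc.prems in auto)
  then obtain F' where F': "F' \<subseteq> F - {e}" "card F' = card (V - insert u S)"
      "V \<subseteq> (adj g F')\<^sup>* `` insert u S" by blast
  have "e \<notin> F'" using F' by auto
  moreover have "finite F'" using F' Suc.prems(2) by (meson finite_Diff finite_subset)
  moreover from \<open>e \<notin> F'\<close> have "(adj g (insert e F'))\<^sup>* `` S = (adj g F')\<^sup>* `` insert u S"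
    using reachable_remove_boundary_edge[of e "insert e F'" g s u S] e by simp
  ultimately show ?case
    using F' card e(1) by (intro exI[of _ "insert e F'"]) auto
qed

section \<open>Walks, cycles and trees in terms of reachability\<close>

lemma walk_imp_rtrancl:
  assumes "multigraph_walk G vs es"
  shows "(hd vs, last vs) \<in> (adj (ends G) (edge_set G))\<^sup>*"
proof -
  have w: "length vs = Suc (length es)" "set es \<subseteq> edge_set G"
      "\<And>i. i < length es \<Longrightarrow> ends G (es ! i) = {vs ! i, vs ! Suc i}"
    using assms by (auto simp: multigraph_walk_def)
  have "(vs ! 0, vs ! i) \<in> (adj (ends G) (edge_set G))\<^sup>*" if "i \<le> length es" for i
    using that
  proof (induction i)
    case (Suc i)
    then have "es ! i \<in> edge_set G" "ends G (es ! i) = {vs ! i, vs ! Suc i}"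
      using w(2) w(3)[of i] nth_mem[of i es] by auto
    then have "(vs ! i, vs ! Suc i) \<in> adj (ends G) (edge_set G)"
      unfolding adj_def by blast
    then show ?case using Suc by (meson Suc_leD rtrancl.rtrancl_into_rtrancl)
  qed simp
  moreover have "vs \<noteq> []" using w(1) by auto
  ultimately show ?thesis using w(1) by (simp add: hd_conv_nth last_conv_nth)
qed

text \<open>The vertices are kept distinct so that the path can later be closed to a cycle.\<close>

lemma rtrancl_imp_path:
  assumes "(u, v) \<in> (adj (ends G) (edge_set G))\<^sup>*" "u \<in> vertices G"
    and "\<forall>e\<in>edge_set G. ends G e \<subseteq> vertices G"
  shows "\<exists>vs es. multigraph_walk G vs es \<and> hd vs = u \<and> last vs = v \<and> distinct vs"
  using assms(1)
proof (induction rule: rtrancl_induct)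
  case base
  have "multigraph_walk G [u] []" using assms(2) by (simp add: multigraph_walk_def)
  then show ?case by (intro exI[of _ "[u]"] exI[of _ "[]"]) simp
next
  case (step y z)
  then obtain vs es where w: "multigraph_walk G vs es" "hd vs = u" "last vs = y" "distinct vs" by blast
  then have len: "length vs = Suc (length es)" by (simp add: multigraph_walk_def)
  obtain e where e: "e \<in> edge_set G" "ends G e = {y, z}" using step.hyps by (auto simp: adj_def)
  show ?case
  proof (cases "z \<in> set vs")
    case True
    \<comment> \<open>The path already passes through \<open>z\<close> and is cut off there;
      \<open>Suc i\<close> vertices go with \<open>i\<close> edges.\<close>
    then obtain i where i: "i < length vs" "vs ! i = z" by (auto simp: in_set_conv_nth)
    have "multigraph_walk G (take (Suc i) vs) (take i es)"
      using w(1) i len by (auto simp: multigraph_walk_def dest: in_set_takeD)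
    moreover have "last (take (Suc i) vs) = z" using i by (simp add: take_Suc_conv_app_nth)
    moreover have "hd (take (Suc i) vs) = u" using w(2) by simp
    moreover have "distinct (take (Suc i) vs)" using w(4) by simp
    ultimately show ?thesis by blast
  next
    case False
    have "vs \<noteq> []" using len by auto
    then have y: "vs ! length es = y" using w(3) len by (simp add: last_conv_nth)
    have "z \<in> vertices G" using e assms(3) by auto
    then have "multigraph_walk G (vs @ [z]) (es @ [e])"
      using w(1) e y len by (auto simp: multigraph_walk_def nth_append less_Suc_eq)
    moreover have "hd (vs @ [z]) = u" using \<open>vs \<noteq> []\<close> w(2) by simp
    ultimately show ?thesis using False w(4) by (intro exI[of _ "vs @ [z]"] exI[of _ "es @ [e]"]) auto
  qed
qed

text \<open>Equal edges have equal pairs of consecutive vertices. Matching them crosswise would need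
  \<open>i = Suc j\<close> and \<open>j = Suc i\<close>, so the positions agree.\<close>

lemma distinct_walk_imp_distinct_edges:
  assumes "multigraph_walk G vs es" "distinct vs"
  shows "distinct es"
  unfolding distinct_conv_nth
proof (intro allI impI notI)
  fix i j assume ij: "i < length es" "j < length es" "i \<noteq> j" "es ! i = es ! j"
  have w: "length vs = Suc (length es)" "\<And>i. i < length es \<Longrightarrow> ends G (es ! i) = {vs ! i, vs ! Suc i}"
    using assms(1) by (auto simp: multigraph_walk_def)
  have "{vs ! i, vs ! Suc i} = {vs ! j, vs ! Suc j}" using w(2) ij by metis
  then show False
    using ij w(1) assms(2) by (auto simp: doubleton_eq_iff nth_eq_iff_index_eq)
qed

text \<open>By symmetry of reachability, any two vertices are joined through
  \<open>r\<close>.\<close>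

lemma multigraph_connected_iff:
  assumes "r \<in> vertices G" "\<forall>e\<in>edge_set G. ends G e \<subseteq> vertices G"
  shows "multigraph_connected G \<longleftrightarrow> vertices G \<subseteq> (adj (ends G) (edge_set G))\<^sup>* `` {r}"
proof
  assume conn: "multigraph_connected G"
  show "vertices G \<subseteq> (adj (ends G) (edge_set G))\<^sup>* `` {r}"
  proof
    fix v assume "v \<in> vertices G"
    then obtain vs es where w: "multigraph_walk G vs es" "hd vs = r" "last vs = v"
      using conn assms(1) unfolding multigraph_connected_def by blast
    then show "v \<in> (adj (ends G) (edge_set G))\<^sup>* `` {r}"
      using walk_imp_rtrancl[OF w(1)] by simp
  qed
next
  assume reach: "vertices G \<subseteq> (adj (ends G) (edge_set G))\<^sup>* `` {r}"
  show "multigraph_connected G"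
    unfolding multigraph_connected_def
  proof (intro conjI ballI)
    fix u v assume uv: "u \<in> vertices G" "v \<in> vertices G"
    then have "(r, u) \<in> (adj (ends G) (edge_set G))\<^sup>*" "(r, v) \<in> (adj (ends G) (edge_set G))\<^sup>*"
      using reach by auto
    then have "(u, v) \<in> (adj (ends G) (edge_set G))\<^sup>*"
      by (meson rtrancl_trans sym_adj_rtrancl)
    then show "\<exists>vs es. multigraph_walk G vs es \<and> hd vs = u \<and> last vs = v"
      using rtrancl_imp_path[OF _ uv(1) assms(2)] by blast
  qed (use assms(1) in auto)
qed

text \<open>Without its last edge \<open>e\<close>, the cycle is still a walk between the ends of
  \<open>e\<close>, and it avoids \<open>e\<close> because the edges are distinct.\<close>

lemma cycle_edge_redundant:
  assumes "multigraph_cycle G vs es"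
  shows "\<exists>e\<in>edge_set G. adj (ends G) (edge_set G) \<subseteq> (adj (ends G) (edge_set G - {e}))\<^sup>*"
proof -
  have c: "multigraph_walk G vs es" "es \<noteq> []" "hd vs = last vs" "distinct es"
    using assms unfolding multigraph_cycle_def by blast+
  have w: "length vs = Suc (length es)" "set vs \<subseteq> vertices G" "set es \<subseteq> edge_set G"
      "\<And>i. i < length es \<Longrightarrow> ends G (es ! i) = {vs ! i, vs ! Suc i}"
    using c(1) by (auto simp: multigraph_walk_def)
  obtain es' e where es: "es = es' @ [e]" using c(2) by (metis rev_exhaust)
  obtain vs' b where vs: "vs = vs' @ [b]" using w(1) by (metis length_0_conv nat.distinct(1) rev_exhaust)
  have len: "length vs' = Suc (length es')" using w(1) es vs by simp
  then have ne: "vs' \<noteq> []" by auto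
  have eG: "e \<in> edge_set G" using w(3) es by simp
  have "multigraph_walk (G\<lparr>edge_set := edge_set G - {e}\<rparr>) vs' es'"
    unfolding multigraph_walk_def
  proof (intro conjI allI impI)
    fix i assume "i < length es'"
    then show "ends (G\<lparr>edge_set := edge_set G - {e}\<rparr>) (es' ! i) = {vs' ! i, vs' ! Suc i}"
      using w(4)[of i] len by (simp add: es vs nth_append)
  qed (use len w c(4) es vs in auto)
  from walk_imp_rtrancl[OF this]
  have path: "(hd vs', last vs') \<in> (adj (ends G) (edge_set G - {e}))\<^sup>*" by simp
  have "hd vs' = b" using c(3) ne vs by simp
  moreover have "ends G e = {last vs', b}"
    using w(4)[of "length es'"] len ne by (simp add: es vs nth_append last_conv_nth)
  ultimately have "adj (ends G) {e} \<subseteq> (adj (ends G) (edge_set G - {e}))\<^sup>*"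
    using path sym_adj_rtrancl[OF path] by (auto simp: adj_def[of _ "{e}"] doubleton_eq_iff)
  moreover have "adj (ends G) (edge_set G) \<subseteq> adj (ends G) {e} \<union> adj (ends G) (edge_set G - {e})"
    by (auto simp: adj_def)
  ultimately show ?thesis using eG by (intro bexI[of _ e]) auto
qed

lemma multigraph_tree_iff:
  assumes G: "finite_loopless_multigraph G" and r: "r \<in> vertices G"
  shows "multigraph_tree G \<longleftrightarrow> card (edge_set G) = card (vertices G - {r}) \<and>
    vertices G \<subseteq> (adj (ends G) (edge_set G))\<^sup>* `` {r}"
proof -
  let ?V = "vertices G" and ?E = "edge_set G" and ?g = "ends G"
  have fin: "finite ?V" "finite ?E" and g: "\<forall>e\<in>?E. ?g e \<subseteq> ?V" "\<forall>e\<in>?E. card (?g e) = 2"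
    using G by (auto simp: finite_loopless_multigraph_def)
  note conn = multigraph_connected_iff[OF r g(1)]
  have "(\<nexists>vs es. multigraph_cycle G vs es) \<longleftrightarrow> card ?E = card (?V - {r})"
    if reach: "?V \<subseteq> (adj ?g ?E)\<^sup>* `` {r}"
  proof
    assume acyc: "\<nexists>vs es. multigraph_cycle G vs es"
    obtain F where F: "F \<subseteq> ?E" "card F = card (?V - {r})" "?V \<subseteq> (adj ?g F)\<^sup>* `` {r}"
      using ex_rooted_forest[OF fin g(1) reach] by blast
    have "F = ?E"
    proof (rule ccontr)
      assume "F \<noteq> ?E"
      then obtain e where e: "e \<in> ?E" "e \<notin> F" using F(1) by blast
      obtain a b where ab: "?g e = {a, b}" "a \<noteq> b" using g(2) e(1) by (meson card_2_iff)
      have inV: "a \<in> ?V" "b \<in> ?V" using g(1) e(1) ab by auto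
      then have "(r, a) \<in> (adj ?g F)\<^sup>*" "(r, b) \<in> (adj ?g F)\<^sup>*" using F(3) by auto
      then have "(a, b) \<in> (adj ?g F)\<^sup>*" by (meson rtrancl_trans sym_adj_rtrancl)
      then have "\<exists>vs es. multigraph_walk (G\<lparr>edge_set := F\<rparr>) vs es \<and> hd vs = a \<and> last vs = b \<and> distinct vs"
        by (intro rtrancl_imp_path) (use inV g(1) F(1) in auto)
      then obtain vs es where w: "multigraph_walk (G\<lparr>edge_set := F\<rparr>) vs es" "hd vs = a"
          "last vs = b" "distinct vs" by blast
      have des: "distinct es" using distinct_walk_imp_distinct_edges[OF w(1,4)] .
      have len: "length vs = Suc (length es)" and es: "set es \<subseteq> F"
        using w(1) by (auto simp: multigraph_walk_def)
      have ne: "vs \<noteq> []" using len by auto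
      have lst: "vs ! length es = b" using w(3) ne len by (simp add: last_conv_nth)
      have "multigraph_walk G (vs @ [a]) (es @ [e])"
        using w(1) F(1) e(1) ab(1) inV lst len
        by (auto simp: multigraph_walk_def nth_append less_Suc_eq)
      \<comment> \<open>The path starts at \<open>a\<close>, so \<open>tl\<close> drops one of the
        two occurrences of \<open>a\<close>.\<close>
      moreover have "distinct (tl (vs @ [a]))"
        using ne w(2,4) by (cases vs) auto
      ultimately have "multigraph_cycle G (vs @ [a]) (es @ [e])"
        using ne w(2) des es e(2) by (auto simp: multigraph_cycle_def)
      then show False using acyc by blast
    qed
    then show "card ?E = card (?V - {r})" using F(2) by simp
  next
    assume card: "card ?E = card (?V - {r})"
    show "\<nexists>vs es. multigraph_cycle G vs es"
    proof
      assume "\<exists>vs es. multigraph_cycle G vs es"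
      then obtain e where e: "e \<in> ?E" "adj ?g ?E \<subseteq> (adj ?g (?E - {e}))\<^sup>*"
        using cycle_edge_redundant by blast
      then have "?V \<subseteq> (adj ?g (?E - {e}))\<^sup>* `` {r}"
        using reach rtrancl_subset_rtrancl[OF e(2)] by blast
      then obtain F where "F \<subseteq> ?E - {e}" "card F = card (?V - {r})"
        using ex_rooted_forest[of ?V "?E - {e}" ?g "{r}"] fin g(1) by auto
      then have "card ?E \<le> card (?E - {e})" using card fin by (metis card_mono finite_Diff)
      then show False using e(1) fin by (metis card_Diff1_less not_less)
    qed
  qed
  then show ?thesis unfolding multigraph_tree_def conn by blast
qed

text \<open>
  Once every vertex is reachable from \<open>S\<close>, the cardinality condition says that \<open>F\<close> is a forest
  in which each component contains exactly one root.
\<close>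

definition rooted_forests :: "('b \<Rightarrow> 'a set) \<Rightarrow> 'a set \<Rightarrow> 'b set \<Rightarrow> 'a set \<Rightarrow> 'b set set" where
  "rooted_forests g V E S = {F. F \<subseteq> E \<and> card F = card (V - S) \<and> V \<subseteq> (adj g F)\<^sup>* `` S}"

lemma spanning_trees_eq_rooted_forests:
  assumes G: "finite_loopless_multigraph G" and r: "r \<in> vertices G"
  shows "spanning_trees G = rooted_forests (ends G) (vertices G) (edge_set G) {r}"
proof -
  have "multigraph_tree (G\<lparr>edge_set := F\<rparr>) \<longleftrightarrow> card F = card (vertices G - {r}) \<and>
      vertices G \<subseteq> (adj (ends G) F)\<^sup>* `` {r}" if F: "F \<subseteq> edge_set G" for F
  proof -
    have "finite_loopless_multigraph (G\<lparr>edge_set := F\<rparr>)"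
      using G F by (auto simp: finite_loopless_multigraph_def finite_subset)
    from multigraph_tree_iff[OF this, of r] r show ?thesis by simp
  qed
  then show ?thesis by (auto simp: spanning_trees_def rooted_forests_def)
qed

text \<open>Forests avoiding \<open>e\<close> form the first family. Deleting \<open>e\<close> from
  the others lowers the edge count by one and reaches the same vertices from
  \<open>insert u S\<close>, whose complement in \<open>V\<close> is one smaller.\<close>

lemma card_rooted_forests_boundary_edge:
  assumes fin: "finite V" "finite E" and e: "e \<in> E" "g e = {s, u}" "s \<in> S" "u \<in> V - S"
  shows "card (rooted_forests g V E S)
    = card (rooted_forests g V (E - {e}) S) + card (rooted_forests g V (E - {e}) (insert u S))"
proof -
  let ?A = "rooted_forests g V (E - {e}) S" and ?B = "rooted_forests g V (E - {e}) (insert u S)"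
  have "V - S = insert u (V - insert u S)" using e(4) by auto
  then have card: "card (V - S) = Suc (card (V - insert u S))"
    using fin(1) by (metis card_insert_disjoint Diff_iff finite_Diff insertI1)
  have rest: "F \<in> rooted_forests g V E S \<longleftrightarrow> F - {e} \<in> ?B" if "e \<in> F" for F
  proof -
    have "card F = Suc (card (F - {e}))" if "F \<subseteq> E"
      using \<open>e \<in> F\<close> that fin(2) by (metis card.remove finite_subset)
    moreover have "F \<subseteq> E \<longleftrightarrow> F - {e} \<subseteq> E - {e}" using e(1) that by auto
    ultimately show ?thesis
      using card reachable_remove_boundary_edge[of e F g s u S] that e(2,3) by (auto simp: rooted_forests_def)
  qed
  have "rooted_forests g V E S = ?A \<union> insert e ` ?B"
  proof (intro Set.set_eqI iffI)
    fix F assume F: "F \<in> rooted_forests g V E S"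
    show "F \<in> ?A \<union> insert e ` ?B"
    proof (cases "e \<in> F")
      case True
      then have "F = insert e (F - {e})" by blast
      then show ?thesis using F rest[OF True] by blast
    next
      case False
      then show ?thesis using F by (auto simp: rooted_forests_def)
    qed
  next
    fix F assume "F \<in> ?A \<union> insert e ` ?B"
    then show "F \<in> rooted_forests g V E S"
    proof
      assume "F \<in> ?A"
      then show ?thesis by (auto simp: rooted_forests_def)
    next
      assume "F \<in> insert e ` ?B"
      then obtain F' where F': "F' \<in> ?B" "F = insert e F'" by blast
      then have "F - {e} = F'" by (auto simp: rooted_forests_def)
      then show ?thesis using F' rest[of F] by blast
    qed
  qed
  moreover have "?A \<inter> insert e ` ?B = {}" by (auto simp: rooted_forests_def)
  moreover have "inj_on (insert e) ?B"
  proof (rule inj_onI)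
    fix F F' assume F: "F \<in> ?B" "F' \<in> ?B" "insert e F = insert e F'"
    then have "e \<notin> F" "e \<notin> F'" by (auto simp: rooted_forests_def)
    then show "F = F'" using F(3) by (simp add: insert_ident)
  qed
  moreover have "finite ?A" "finite ?B"
    using fin(2) by (auto simp: rooted_forests_def)
  ultimately show ?thesis by (simp add: card_Un_disjoint card_image)
qed

section \<open>The Laplacian and the matrix-tree theorem\<close>

text \<open>For \<open>X = {s, t}\<close> with \<open>s \<noteq> t\<close> this is the Laplacian of
  a single edge, the rank-one matrix \<open>(e_s - e_t) (e_s - e_t)^T\<close>.\<close>

definition incidence :: "'a set \<Rightarrow> 'a \<Rightarrow> 'a \<Rightarrow> real" where
  "incidence X u v = (if u \<in> X \<and> v \<in> X then (if u = v then 1 else - 1) else 0)"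

text \<open>Summing over edges, rather than starting from degrees and multiplicities, makes deletion
  of an edge the removal of one summand.\<close>

definition laplacian :: "('b \<Rightarrow> 'a set) \<Rightarrow> 'b set \<Rightarrow> 'a \<Rightarrow> 'a \<Rightarrow> real" where
  "laplacian g E u v = (\<Sum>e\<in>E. incidence (g e) u v)"

lemma laplacian_commute: "laplacian g E u v = laplacian g E v u"
  by (auto simp: laplacian_def incidence_def intro!: sum.cong)

text \<open>An end outside \<open>U\<close> contributes as if \<open>x\<close> were \<open>0\<close>
  there, which covers edges crossing the boundary of \<open>U\<close>.\<close>

lemma sum_incidence:
  fixes x :: "'a \<Rightarrow> real"
  assumes "finite U" "s \<noteq> t" "u \<in> U"
  shows "(\<Sum>v\<in>U. incidence {s, t} u v * x v) =
    (if u = s then x s - (if t \<in> U then x t else 0) else if u = t then x t - (if s \<in> U then x s else 0) else 0)"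
proof -
  have "(\<Sum>v\<in>U. incidence {s, t} u v * x v) =
      (\<Sum>v\<in>U. (if v = s then incidence {s, t} u s * x s else 0) + (if v = t then incidence {s, t} u t * x t else 0))"
    by (rule sum.cong) (use assms(2) in \<open>auto simp: incidence_def\<close>)
  also have "\<dots> = (if s \<in> U then incidence {s, t} u s * x s else 0) + (if t \<in> U then incidence {s, t} u t * x t else 0)"
    using assms(1) by (simp add: sum.distrib)
  finally show ?thesis using assms(2,3) by (auto simp: incidence_def)
qed

lemma sum_laplacian:
  "(\<Sum>v\<in>U. laplacian g E u v * x v) = (\<Sum>e\<in>E. \<Sum>v\<in>U. incidence (g e) u v * x v)"
  unfolding laplacian_def sum_distrib_right by (rule sum.swap)

text \<open>Each edge at \<open>u\<close> has both ends in \<open>U\<close> and contributes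
  \<open>1 - 1\<close>. This is applied to \<open>V\<close>, and to \<open>V - S\<close> when no
  edge leaves it.\<close>

lemma sum_laplacian_row_eq_0:
  assumes "finite U" "\<forall>e\<in>E. card (g e) = 2" "u \<in> U" "\<forall>e\<in>E. u \<in> g e \<longrightarrow> g e \<subseteq> U"
  shows "(\<Sum>v\<in>U. laplacian g E u v) = 0"
proof -
  have "(\<Sum>v\<in>U. incidence (g e) u v * 1) = 0" if e: "e \<in> E" for e
  proof -
    obtain s t where st: "g e = {s, t}" "s \<noteq> t" using assms(2) e by (meson card_2_iff)
    then have "u = s \<or> u = t \<Longrightarrow> s \<in> U \<and> t \<in> U" using assms(4) e by auto
    then show ?thesis
      unfolding st(1) by (subst sum_incidence) (use assms st(2) in auto)
  qed
  then show ?thesis using sum_laplacian[of g E u "\<lambda>_. 1" U] by simp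
qed

text \<open>After exchanging the sums, an edge with ends \<open>s\<close> and \<open>t\<close>
  contributes \<open>(x s - x t)\<^sup>2\<close>.\<close>

lemma bilinear_on_laplacian_nonneg:
  assumes "finite V" "\<forall>e\<in>E. g e \<subseteq> V \<and> card (g e) = 2"
  shows "bilinear_on V (laplacian g E) x x \<ge> 0"
proof -
  have "bilinear_on V (laplacian g E) x x = (\<Sum>u\<in>V. \<Sum>e\<in>E. x u * (\<Sum>v\<in>V. incidence (g e) u v * x v))"
    unfolding bilinear_on_def sum_laplacian sum_distrib_left[of _ _ E] ..
  also have "\<dots> = (\<Sum>e\<in>E. \<Sum>u\<in>V. x u * (\<Sum>v\<in>V. incidence (g e) u v * x v))"
    by (rule sum.swap)
  also have "\<dots> \<ge> 0"
  proof (rule sum_nonneg)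
    fix e assume e: "e \<in> E"
    obtain s t where st: "g e = {s, t}" "s \<noteq> t" using assms(2) e by (meson card_2_iff)
    then have V: "s \<in> V" "t \<in> V" using assms(2) e by auto
    have "(\<Sum>u\<in>V. x u * (\<Sum>v\<in>V. incidence (g e) u v * x v))
        = (\<Sum>u\<in>V. (if u = s then x s * (x s - x t) else 0) + (if u = t then x t * (x t - x s) else 0))"
      by (rule sum.cong) (use st V assms(1) in \<open>auto simp: sum_incidence\<close>)
    also have "\<dots> = (x s - x t)\<^sup>2"
      using V assms(1) by (simp add: sum.distrib power2_eq_square algebra_simps)
    finally show "(\<Sum>u\<in>V. x u * (\<Sum>v\<in>V. incidence (g e) u v * x v)) \<ge> 0" by simp
  qed
  finally show ?thesis .
qed

text \<open>The constant matrix adds \<open>c\<close> times the square of the sum of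
  \<open>x\<close> to the form.\<close>

lemma psd_on_laplacian_add_const:
  assumes "finite V" "\<forall>e\<in>E. g e \<subseteq> V \<and> card (g e) = 2" "c \<ge> 0"
  shows "psd_on V (\<lambda>u v. laplacian g E u v + c)"
  unfolding psd_on_def
proof (intro conjI allI ballI)
  fix u v show "laplacian g E u v + c = laplacian g E v u + c"
    using laplacian_commute[of g E u v] by simp
next
  fix x :: "'a \<Rightarrow> real"
  have "bilinear_on V (\<lambda>u v. laplacian g E u v + c) x x
      = bilinear_on V (laplacian g E) x x + c * (\<Sum>v\<in>V. x v)\<^sup>2"
    by (simp add: bilinear_on_def algebra_simps sum.distrib power2_eq_square
        sum_distrib_left[symmetric] sum_distrib_right[symmetric])
  then show "bilinear_on V (\<lambda>u v. laplacian g E u v + c) x x \<ge> 0"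
    using bilinear_on_laplacian_nonneg[OF assms(1,2), of x] assms(3) by simp
qed

lemma laplacian_diagonal:
  assumes "finite_loopless_multigraph G"
  shows "laplacian (ends G) (edge_set G) v v = real (vertex_degree G v)"
proof -
  have "laplacian (ends G) (edge_set G) v v = (\<Sum>e\<in>edge_set G. if v \<in> ends G e then 1 else 0)"
    by (auto simp: laplacian_def incidence_def intro!: sum.cong)
  also have "\<dots> = real (vertex_degree G v)"
    using assms by (simp add: vertex_degree_def finite_loopless_multigraph_def sum.If_cases Int_def)
  finally show ?thesis .
qed

lemma laplacian_off_diagonal:
  assumes "finite_loopless_multigraph G" "u \<noteq> v"
  shows "laplacian (ends G) (edge_set G) u v = - real (edge_multiplicity G u v)"
proof -
  have "u \<in> ends G e \<and> v \<in> ends G e \<longleftrightarrow> ends G e = {u, v}" if "e \<in> edge_set G" for e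
  proof -
    have "card (ends G e) = 2" using assms(1) that by (auto simp: finite_loopless_multigraph_def)
    then obtain s t where "ends G e = {s, t}" by (meson card_2_iff)
    then show ?thesis using assms(2) by auto
  qed
  then have "laplacian (ends G) (edge_set G) u v = (\<Sum>e\<in>edge_set G. if ends G e = {u, v} then - 1 else 0)"
    unfolding laplacian_def incidence_def by (intro sum.cong) (use assms(2) in auto)
  also have "\<dots> = - real (edge_multiplicity G u v)"
    using assms by (simp add: edge_multiplicity_def finite_loopless_multigraph_def sum.If_cases Int_def)
  finally show ?thesis .
qed

section \<open>Matrix-tree theorem for rooted forests\<close>

context enumeration
begin

lemma card_rooted_forests_eq_pdet:
  assumes "finite E" "\<forall>e\<in>E. g e \<subseteq> V \<and> card (g e) = 2" "S \<subseteq> V"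
  shows "real (card (rooted_forests g V E S)) = pdet (V - S) (laplacian g E)"
  using assms
proof (induction "card E" arbitrary: E S rule: less_induct)
  case less
  note fin = finite_V \<open>finite E\<close>
  show ?case
  proof (cases "\<exists>e\<in>E. \<exists>s\<in>S. \<exists>u. u \<notin> S \<and> g e = {s, u}")
    case True
    then obtain e s u where e: "e \<in> E" "s \<in> S" "u \<notin> S" "g e = {s, u}" by blast
    then have u: "u \<in> V - S" using less.prems by auto
    have smaller: "card (E - {e}) < card E" using e(1) fin by (metis card_Diff1_less)
    \<comment> \<open>The induction leaves the root set arbitrary because the recursion also
      enlarges it.\<close>
    have IH: "real (card (rooted_forests g V (E - {e}) T)) = pdet (V - T) (laplacian g (E - {e}))"
      if "T \<subseteq> V" for T
      by (rule less.hyps[OF smaller]) (use less.prems that in auto)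
    have "pdet (V - S) (laplacian g E)
        = pdet (V - S) (\<lambda>v w. laplacian g (E - {e}) v w + (if v = u \<and> w = u then 1 else 0))"
    proof (rule pdet_cong)
      fix v w assume vw: "v \<in> V - S" "w \<in> V - S"
      have "laplacian g E v w = incidence (g e) v w + laplacian g (E - {e}) v w"
        unfolding laplacian_def using e(1) fin(2) by (rule sum.remove[rotated])
      \<comment> \<open>The end \<open>s\<close> is a root and thus outside \<open>V - S\<close>, so
        \<open>e\<close> only touches the diagonal entry at \<open>u\<close>.\<close>
      moreover have "incidence (g e) v w = (if v = u \<and> w = u then 1 else 0)"
        using vw e by (auto simp: incidence_def)
      ultimately show "laplacian g E v w = laplacian g (E - {e}) v w + (if v = u \<and> w = u then 1 else 0)"
        by simp
    qed
    also have "\<dots> = pdet (V - S) (laplacian g (E - {e})) + 1 * pdet (V - S - {u}) (laplacian g (E - {e}))"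
      by (rule pdet_add_diag) (use u in auto)
    also have "V - S - {u} = V - insert u S" by auto
    also have "pdet (V - S) (laplacian g (E - {e})) + 1 * pdet (V - insert u S) (laplacian g (E - {e}))
        = real (card (rooted_forests g V E S))"
      unfolding card_rooted_forests_boundary_edge[where g = g, OF fin e(1,4,2) u]
      using IH[of S] IH[of "insert u S"] less.prems(3) u by simp
    finally show ?thesis ..
  next
    case no_boundary: False
    show ?thesis
    proof (cases "V \<subseteq> S")
      case True
      then have "S = V" using less.prems(3) by blast
      \<comment> \<open>With all vertices as roots, the empty set is the only forest and the minor
        is empty, so both sides are \<open>1\<close>.\<close>
      have "rooted_forests g V E S = {{}}"
        using fin(2) unfolding \<open>S = V\<close> rooted_forests_def by (auto simp: finite_subset)
      then show ?thesis using \<open>S = V\<close> by simp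
    next
      case False
      then obtain u where u: "u \<in> V - S" by blast
      have "rooted_forests g V E S = {}"
      proof (rule ccontr)
        assume "rooted_forests g V E S \<noteq> {}"
        then obtain F where "F \<subseteq> E" "V \<subseteq> (adj g F)\<^sup>* `` S" by (auto simp: rooted_forests_def)
        then show False using ex_boundary_edge[OF _ False] no_boundary by blast
      qed
      moreover have "pdet (V - S) (laplacian g E) = 0"
      proof -
        \<comment> \<open>No edge joins \<open>S\<close> to its complement, so the rows sum to
          \<open>0\<close> on \<open>V - S\<close> and the all-ones vector is a nonzero kernel
          vector.\<close>
        have "(\<Sum>v\<in>V - S. laplacian g E w v * 1) = 0" if w: "w \<in> V - S" for w
        proof -
          have "g e \<subseteq> V - S" if e: "e \<in> E" "w \<in> g e" for e
          proof -
            obtain a b where ab: "g e = {a, b}" using less.prems(2) e(1) by (meson card_2_iff)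
            have "\<forall>s\<in>S. \<forall>t. g e = {s, t} \<longrightarrow> t \<in> S" using no_boundary e(1) by blast
            then have "a \<notin> S \<and> b \<notin> S" using ab e(2) w by (auto simp: insert_commute)
            then show ?thesis using ab less.prems(2) e(1) by auto
          qed
          then have "(\<Sum>v\<in>V - S. laplacian g E w v) = 0"
            using fin less.prems(2) w by (intro sum_laplacian_row_eq_0) auto
          then show ?thesis by simp
        qed
        then show ?thesis
          unfolding pdet_eq_0_iff[OF Diff_subset] using u by (intro exI[of _ "\<lambda>_. 1"]) auto
      qed
      ultimately show ?thesis by simp
    qed
  qed
qed

end

section \<open>Degree sequence and the final inequality\<close>

text \<open>The product is symmetric, so passing to multisets removes the sorting.\<close>

lemma prod_degree_sequence:
  assumes "finite (vertices G)"
  shows "(\<Prod>i<card (vertices G). f (degree_sequence G ! i)) = (\<Prod>v\<in>vertices G. f (vertex_degree G v) :: real)"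
proof -
  have mset: "mset (degree_sequence G) = image_mset (vertex_degree G) (mset_set (vertices G))"
    by (simp add: degree_sequence_def)
  then have len: "length (degree_sequence G) = card (vertices G)"
    by (metis size_image_mset size_mset size_mset_set)
  have "(\<Prod>i<card (vertices G). f (degree_sequence G ! i)) = prod_list (map f (degree_sequence G))"
    using len by (simp add: prod.list_conv_set_nth lessThan_atLeast0)
  also have "\<dots> = prod_mset (image_mset f (mset (degree_sequence G)))"
    by (simp add: prod_mset_prod_list flip: mset_map)
  also have "\<dots> = (\<Prod>v\<in>vertices G. f (vertex_degree G v))"
    unfolding mset by (simp add: prod_unfold_prod_mset multiset.map_comp comp_def)
  finally show ?thesis .
qed

theorem mainTheorem3:
  fixes G :: "('a, 'b) multigraph"
    and n \<Delta> :: nat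
    and d :: "nat list"
  assumes "finite_loopless_multigraph G"
    and "n = card (vertices G)"
    and "\<Delta> = max_multiplicity G"
    and "\<Delta> \<ge> 1"
    and "d = degree_sequence G"
  shows "real (num_spanning_trees G)
           \<le> (\<Prod>i<n. real \<Delta> + real (d ! i)) / (real \<Delta> * (real n)^2) \<and>
         (real (num_spanning_trees G)
           = (\<Prod>i<n. real \<Delta> + real (d ! i)) / (real \<Delta> * (real n)^2)
           \<longleftrightarrow> complete_multigraph \<Delta> G)"
proof -
  let ?V = "vertices G" and ?L = "laplacian (ends G) (edge_set G)"
  let ?A = "\<lambda>u v. ?L u v + real \<Delta>"
  have fin: "finite ?V" "finite (edge_set G)"
    and g: "\<forall>e\<in>edge_set G. ends G e \<subseteq> ?V \<and> card (ends G e) = 2"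
    using assms(1) by (auto simp: finite_loopless_multigraph_def)
  have "?V \<noteq> {}"
  proof
    assume V: "?V = {}"
    \<comment> \<open>Without vertices only the inserted \<open>0\<close> is left under the maximum,
      against \<open>\<Delta> \<ge> 1\<close>.\<close>
    have "max_multiplicity G = Max {0}"
      unfolding max_multiplicity_def V by (rule arg_cong[of _ _ Max]) auto
    then show False using assms(3,4) by simp
  qed
  then have n: "n > 0" using assms(2) fin by (simp add: card_gt_0_iff)
  obtain h where "bij_betw h {0..<n} ?V"
    using ex_bij_betw_nat_finite[OF fin(1)] assms(2) by blast
  then interpret enumeration h n ?V
    by unfold_locales (simp add: lessThan_atLeast0)
  \<comment> \<open>The root is \<open>h 0\<close> because this is the vertex that
    \<open>pdet_add_const\<close> removes.\<close>
  have r: "h 0 \<in> ?V" using n h_in by simp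
  have rows: "(\<Sum>v\<in>?V. ?L u v) = 0" if "u \<in> ?V" for u
    by (rule sum_laplacian_row_eq_0) (use fin g that in auto)
  have "real (num_spanning_trees G) = pdet (?V - {h 0}) ?L"
    unfolding num_spanning_trees_def spanning_trees_eq_rooted_forests[OF assms(1) r]
    by (rule card_rooted_forests_eq_pdet[OF fin(2) g]) (use r in simp)
  moreover have "pdet ?V ?A = real \<Delta> * (real n)\<^sup>2 * pdet (?V - {h 0}) ?L"
  proof (rule pdet_add_const[OF n rows])
    show "(\<Sum>u\<in>?V. ?L u v) = 0" if "v \<in> ?V" for v
      unfolding laplacian_commute[of _ _ _ v] by (rule rows[OF that])
  qed
  \<comment> \<open>Multiplying out the denominator of the bound turns the claim into Hadamard's
    inequality for \<open>?A\<close>.\<close>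
  ultimately have tau: "pdet ?V ?A = real (num_spanning_trees G) * (real \<Delta> * (real n)\<^sup>2)" by simp
  have pos: "real \<Delta> * (real n)\<^sup>2 > 0" using n assms(4) by simp
  have diag: "?A v v = real \<Delta> + real (vertex_degree G v)" for v
    by (simp add: laplacian_diagonal[OF assms(1)])
  then have diag_pos: "?A v v > 0" for v using assms(4) by simp
  have prod: "(\<Prod>i<n. real \<Delta> + real (d ! i)) = (\<Prod>v\<in>?V. ?A v v)"
    unfolding diag assms(2,5) by (rule prod_degree_sequence[OF fin(1)])
  have psd: "psd_on ?V ?A"
    by (rule psd_on_laplacian_add_const[OF fin(1) g]) simp
  have "(\<forall>u\<in>?V. \<forall>v\<in>?V. u \<noteq> v \<longrightarrow> ?A u v = 0) \<longleftrightarrow> complete_multigraph \<Delta> G"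
    unfolding complete_multigraph_def
    by (auto simp: laplacian_off_diagonal[OF assms(1)])
  then have "pdet ?V ?A = (\<Prod>v\<in>?V. ?A v v) \<longleftrightarrow> complete_multigraph \<Delta> G"
    using hadamard_eq_iff[OF subset_refl psd diag_pos] by (rule trans[rotated])
  moreover have "pdet ?V ?A \<le> (\<Prod>v\<in>?V. ?A v v)"
    using hadamard_inequality[OF fin(1) subset_refl psd diag_pos] by (elim conjE)
  ultimately show ?thesis
    unfolding prod tau using pos n assms(4) by (simp add: pos_le_divide_eq eq_divide_eq)
qed

end
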